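(* Let $d\ge1$, let $G$ be a $(d+1)$-regular graph on the vertex set $V=\{1,\dots,n\}$, and let $A$ be a generalized adjacency matrix for $G$. Then for all $k\ge1$, $$\sum_\gamma A(\gamma)=\begin{cases}\mathrm{Tr}\left[2d^{k/2}\,T_k\!\left(\frac{A}{2\sqrt d}\right)\right], & \text{if } k \text{ is odd},\\[4pt] \mathrm{Tr}\left[2d^{k/2}\,T_k\!\left(\frac{A}{2\sqrt d}\right)+(d-1)I_n\right], & \text{if } k\text{ is even},\end{cases}$$ where the sum on the left-hand side is over all closed non-backtracking tailless paths $\gamma$ of length $k$ in $G$, and $T_k$ is the Chebyshev polynomial of the first kind.
   Context: Graphs are finite and simple. A generalized adjacency matrix for $G$ is an $n\times n$ Hermitian matrix $A$ with $|A_{uv}|=1$ if $(u,v)$ is an edge of $G$ and $A_{uv}=0$ otherwise. A path of length $k$ is a sequence of vertices $\gamma=(u_0,u_1,\dots,u_k)$ with consecutive vertices adjacent in $G$. It is non-backtracking if $u_{j+1}\ne u_{j-1}$ for all $1\le j\le k-1$; closed if $u_k=u_0$. A closed path is non-backtracking tailless if it is non-backtracking and $u_{k-1}\ne u_1$. (Paths are sequences, so different starting points or orientations give different paths.) For a path $\gamma=(u_0,\dots,u_k)$, $A(\gamma):=A_{u_0u_1}A_{u_1u_2}\cdots A_{u_{k-1}u_k}$. Chebyshev polynomials of the first kind: $T_k(\cos\theta)=\cos k\theta$. $I_n$ is the identity matrix. *)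

theory Defs
  imports
    "HOL-Analysis.Analysis"
    "HOL-Computational_Algebra.Polynomial"
    "Graph_Theory.Graph_Theory"
begin

text \<open>
  A finite simple graph is a \<^locale>\<open>pair_graph\<close>: a finite loop-free symmetric digraph in which
  the undirected edge between \<open>u\<close> and \<open>v\<close> is represented by the two arcs \<open>(u, v)\<close> and \<open>(v, u)\<close>.
  The vertices are the indices of the matrix, i.e. the elements of a finite type \<open>'n\<close>
  in place of \<open>1, \<dots>, n\<close> with \<open>n = CARD('n)\<close>.
\<close>

definition hermitian :: "complex ^ 'n ^ 'n \<Rightarrow> bool" where
  "hermitian A \<longleftrightarrow> (\<forall>u v. A $ u $ v = cnj (A $ v $ u))"

definition generalized_adjacency_matrix ::
    "'n pair_pre_digraph \<Rightarrow> complex ^ 'n ^ 'n \<Rightarrow> bool" where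
  "generalized_adjacency_matrix G A \<longleftrightarrow> hermitian A \<and>
     (\<forall>u v. if (u, v) \<in> parcs G then norm (A $ u $ v) = 1 else A $ u $ v = 0)"

definition regular_graph :: "nat \<Rightarrow> 'a pair_pre_digraph \<Rightarrow> bool" where
  "regular_graph r G \<longleftrightarrow> (\<forall>v \<in> pverts G. out_degree (with_proj G) v = r)"

text \<open>
  A path of length \<open>k\<close> is a \<^const>\<open>vwalk\<close> \<open>\<gamma>\<close>, given by its list \<open>[u\<^sub>0, \<dots>, u\<^sub>k]\<close> of \<open>k + 1\<close> vertices,
  and \<open>k = vwalk_length \<gamma>\<close>. Vertices may repeat.
\<close>

definition nonbacktracking :: "'a vwalk \<Rightarrow> bool" where
  "nonbacktracking \<gamma> \<longleftrightarrow>
     (\<forall>j. 1 \<le> j \<and> j + 1 \<le> vwalk_length \<gamma> \<longrightarrow> \<gamma> ! (j + 1) \<noteq> \<gamma> ! (j - 1))"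

definition closed_path :: "'a vwalk \<Rightarrow> bool" where
  "closed_path \<gamma> \<longleftrightarrow> \<gamma> ! vwalk_length \<gamma> = \<gamma> ! 0"

text \<open>Only meaningful for closed paths of length at least 1.\<close>

definition nonbacktracking_tailless :: "'a vwalk \<Rightarrow> bool" where
  "nonbacktracking_tailless \<gamma> \<longleftrightarrow>
     nonbacktracking \<gamma> \<and> \<gamma> ! (vwalk_length \<gamma> - 1) \<noteq> \<gamma> ! 1"

definition closed_nb_tailless_paths :: "'a pair_pre_digraph \<Rightarrow> nat \<Rightarrow> 'a vwalk set" where
  "closed_nb_tailless_paths G k =
     {\<gamma>. vwalk \<gamma> (with_proj G) \<and> vwalk_length \<gamma> = k \<and>
         closed_path \<gamma> \<and> nonbacktracking_tailless \<gamma>}"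

definition path_weight :: "complex ^ 'n ^ 'n \<Rightarrow> 'n vwalk \<Rightarrow> complex" where
  "path_weight A \<gamma> = (\<Prod>j<vwalk_length \<gamma>. A $ (\<gamma> ! j) $ (\<gamma> ! (j + 1)))"

definition chebyshev_T :: "nat \<Rightarrow> real poly" where
  "chebyshev_T k = (THE p. \<forall>\<theta>. poly p (cos \<theta>) = cos (real k * \<theta>))"

lemma chebyshev_T_ex: "\<exists>p. \<forall>\<theta>. poly p (cos \<theta>) = cos (real k * \<theta>)"
proof (induction k rule: less_induct)
  case (less k)
  consider "k = 0" | "k = 1" | m where "k = Suc (Suc m)"
    by (metis One_nat_def not0_implies_Suc)
  then show ?case
  proof cases
    case 1
    then show ?thesis by (intro exI[of _ 1]) auto
  next
    case 2
    then show ?thesis by (intro exI[of _ "[:0, 1:]"]) auto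
  next
    case 3
    obtain p where p: "\<And>\<theta>. poly p (cos \<theta>) = cos (real m * \<theta>)"
      using less.IH[of m] 3 by auto
    obtain q where q: "\<And>\<theta>. poly q (cos \<theta>) = cos (real (Suc m) * \<theta>)"
      using less.IH[of "Suc m"] 3 by auto
    have "poly ([:0, 2:] * q - p) (cos \<theta>) = cos (real k * \<theta>)" for \<theta>
    proof -
      have "cos (real (Suc m) * \<theta> + \<theta>) + cos (real (Suc m) * \<theta> - \<theta>)
          = 2 * cos \<theta> * cos (real (Suc m) * \<theta>)"
        by (simp add: cos_add cos_diff)
      moreover have "real (Suc m) * \<theta> + \<theta> = real k * \<theta>" "real (Suc m) * \<theta> - \<theta> = real m * \<theta>"
        using 3 by (auto simp: algebra_simps)
      ultimately show ?thesis by (simp add: p q)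
    qed
    then show ?thesis by blast
  qed
qed

lemma chebyshev_T_unique:
  assumes "\<And>\<theta>. poly p (cos \<theta>) = cos (real k * \<theta>)" "\<And>\<theta>. poly q (cos \<theta>) = cos (real k * \<theta>)"
  shows "p = q"
proof (rule ccontr)
  assume "p \<noteq> q"
  then have "finite {x. poly (p - q) x = 0}"
    by (intro poly_roots_finite) simp
  moreover have "{-1..1} \<subseteq> {x. poly (p - q) x = 0}"
  proof
    fix x :: real
    assume "x \<in> {-1..1}"
    then have "cos (arccos x) = x" by (intro cos_arccos) auto
    then show "x \<in> {x. poly (p - q) x = 0}"
      using assms[of "arccos x"] by simp
  qed
  ultimately have "finite {-1..1::real}" by (rule finite_subset[rotated])
  then show False using infinite_Icc[of "-1::real" 1] by simp
qed

lemma poly_chebyshev_T_cos: "poly (chebyshev_T k) (cos \<theta>) = cos (real k * \<theta>)"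
proof -
  have "\<exists>!p. \<forall>\<theta>. poly p (cos \<theta>) = cos (real k * \<theta>)"
    using chebyshev_T_ex chebyshev_T_unique by blast
  from theI'[OF this] show ?thesis unfolding chebyshev_T_def by blast
qed

text \<open>
  The matrix product is \<open>(**)\<close>; \<open>(*)\<close> on \<open>complex ^ 'n ^ 'n\<close> is entrywise.
\<close>

definition matrix_power :: "complex ^ 'n ^ 'n \<Rightarrow> nat \<Rightarrow> complex ^ 'n ^ 'n" where
  "matrix_power A i = (((**) A) ^^ i) (mat 1)"

definition poly_matrix :: "real poly \<Rightarrow> complex ^ 'n ^ 'n \<Rightarrow> complex ^ 'n ^ 'n" where
  "poly_matrix p A = (\<Sum>i\<le>degree p. coeff p i *\<^sub>R matrix_power A i)"

end

theory Submission
  imports Defs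
begin

text \<open>
  Let \<open>B\<^sub>k\<close> be the matrix whose entry at \<open>(u, v)\<close> is the total weight of the non-backtracking walks of
  length \<open>k\<close> from \<open>u\<close> to \<open>v\<close>, and let \<open>N\<^sub>k\<close> be the total weight of the closed tailless ones.

  Prepending an arc to a non-backtracking walk either gives a non-backtracking walk or a walk that
  begins with a detour along an arc and back. The detour has weight \<open>1\<close>, because \<open>A\<close> is Hermitian with
  entries of modulus 1 on arcs, and a given remaining walk admits \<open>d\<close> detours. Hence
  \<open>A B\<^sub>k = B\<^sub>k\<^sub>+\<^sub>1 + d B\<^sub>k\<^sub>-\<^sub>1\<close> for \<open>k \<ge> 2\<close> (\<open>mult_nb_walk_matrix_Suc\<close>), with \<open>d + 1\<close> in place of \<open>d\<close>
  for \<open>k = 1\<close>.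

  A closed non-backtracking walk with a tail goes along an arc, around a closed non-backtracking walk
  that is shorter by two, and back along the arc. Conversely such an inner walk can be extended in
  \<open>d - 1\<close> ways if it is tailless and in \<open>d\<close> ways if it has a tail. For the total weight
  \<open>t\<^sub>k = Tr B\<^sub>k - N\<^sub>k\<close> of the walks with a tail this says \<open>t\<^sub>k = (d - 1) Tr B\<^sub>k\<^sub>-\<^sub>2 + t\<^sub>k\<^sub>-\<^sub>2\<close>
  (\<open>tailed_sum_rec\<close>), and therefore \<open>N\<^sub>k - N\<^sub>k\<^sub>-\<^sub>2 = Tr (B\<^sub>k - d B\<^sub>k\<^sub>-\<^sub>2)\<close> for \<open>k \<ge> 3\<close>.

  The matrices \<open>P\<^sub>k = 2 d\<^sup>k\<^sup>/\<^sup>2 T\<^sub>k(A / (2 \<surd>d))\<close> satisfy \<open>P\<^sub>k\<^sub>+\<^sub>1 = A P\<^sub>k - d P\<^sub>k\<^sub>-\<^sub>1\<close> by the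
  three-term recursion of the Chebyshev polynomials, and comparing recursions gives
  \<open>P\<^sub>k - P\<^sub>k\<^sub>-\<^sub>2 = B\<^sub>k - d B\<^sub>k\<^sub>-\<^sub>2\<close> for \<open>k \<ge> 3\<close> (\<open>scaled_chebyshev_increment\<close>). So \<open>N\<^sub>k - Tr P\<^sub>k\<close> depends only
  on the parity of \<open>k\<close>; it is \<open>0\<close> for \<open>k = 1\<close> and \<open>(d - 1) n\<close> for \<open>k = 2\<close>, where \<open>n\<close> is the number of
  vertices.
\<close>


section \<open>Sums over a type with one value left out\<close>

lemma sum_UNIV_minus_singleton:
  fixes f :: "'n::finite \<Rightarrow> 'a::ab_group_add"
  shows "(\<Sum>x\<in>UNIV - {a}. f x) = (\<Sum>x\<in>UNIV. f x) - f a"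
  by (simp add: sum_diff1)

text \<open>
  The next two lemmas count, with weights \<open>w\<close>, the vertices \<open>u\<close> that avoid one or two given
  neighbours of a vertex. The hypotheses express that \<open>w\<close> acts as \<open>1\<close> on the values of \<open>f\<close>, so
  that leaving out a value decreases the weighted count by exactly one.
\<close>

lemma weighted_sum_avoiding:
  fixes w f :: "'n::finite \<Rightarrow> 'a::comm_ring_1"
  assumes "\<And>u. w u * f u = f u"
  shows "(\<Sum>u\<in>UNIV. w u * (\<Sum>x\<in>UNIV - {u}. f x)) = (sum w UNIV - 1) * sum f UNIV"
proof -
  have "(\<Sum>u\<in>UNIV. w u * (\<Sum>x\<in>UNIV - {u}. f x)) = (\<Sum>u\<in>UNIV. w u * sum f UNIV - f u)"
    by (simp add: sum_UNIV_minus_singleton right_diff_distrib assms)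
  then show ?thesis
    by (simp add: sum_subtractf sum_distrib_right left_diff_distrib)
qed

lemma weighted_sum_avoiding2:
  fixes w :: "'n::finite \<Rightarrow> 'a::comm_ring_1"
  assumes row: "\<And>u y. w u * f u y = f u y" and column: "\<And>u x. w u * f x u = f x u"
  shows "(\<Sum>u\<in>UNIV. w u * (\<Sum>x\<in>UNIV - {u}. \<Sum>y\<in>UNIV - {u}. f x y)) =
    (sum w UNIV - 2) * (\<Sum>x\<in>UNIV. \<Sum>y\<in>UNIV. f x y) + (\<Sum>x\<in>UNIV. f x x)"
proof -
  \<comment> \<open>Inclusion-exclusion: the pair \<open>x = y = u\<close> is subtracted twice and has to be added back.\<close>
  let ?S = "\<Sum>x\<in>UNIV. \<Sum>y\<in>UNIV. f x y"
  have "w u * (\<Sum>x\<in>UNIV - {u}. \<Sum>y\<in>UNIV - {u}. f x y) =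
      w u * ?S - (\<Sum>x\<in>UNIV. f x u) - (\<Sum>y\<in>UNIV. f u y) + f u u" for u
    by (simp add: sum_UNIV_minus_singleton sum_subtractf right_diff_distrib
        sum_distrib_left[of "w u"] row column)
  moreover have "(\<Sum>u\<in>UNIV. \<Sum>x\<in>UNIV. f x u) = ?S"
    by (rule sum.swap)
  ultimately show ?thesis
    by (simp add: sum_subtractf sum.distrib flip: sum_distrib_right) (simp add: algebra_simps)
qed


section \<open>Walk sums with prescribed first and last arc\<close>

text \<open>
  The arc (Hashimoto) matrix formalism: \<open>arc_walk_sum A m a b c e\<close> is the total weight of the
  non-backtracking walks of length \<open>m + 1\<close> that start with the arc \<open>(a, b)\<close> and end with the
  arc \<open>(c, e)\<close>. Fixing arcs rather than vertices makes both the non-backtracking condition at the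
  two ends and the tail condition visible in the arguments.
\<close>

primrec arc_walk_sum ::
    "complex ^ 'n ^ 'n \<Rightarrow> nat \<Rightarrow> 'n::finite \<Rightarrow> 'n \<Rightarrow> 'n \<Rightarrow> 'n \<Rightarrow> complex" where
  "arc_walk_sum A 0 a b c e = (if a = c \<and> b = e then A $ a $ b else 0)"
| "arc_walk_sum A (Suc m) a b c e = A $ a $ b * (\<Sum>x\<in>UNIV - {a}. arc_walk_sum A m b x c e)"

text \<open>
  Walks can equally be shortened at the end: for fixed \<open>m\<close> the sums are essentially the entries of the
  \<open>m\<close>-th power of one arc-indexed matrix, and powers can be split off from either side.
\<close>

lemma arc_walk_sum_Suc_last:
  "arc_walk_sum A (Suc m) a b c e = (\<Sum>y\<in>UNIV - {e}. arc_walk_sum A m a b y c) * A $ c $ e"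
proof (induction m arbitrary: a b)
  case 0
  show ?case
    by (cases "b = c"; cases "a = e") (auto simp: sum.neutral)
next
  case (Suc m)
  have "arc_walk_sum A (Suc (Suc m)) a b c e =
      A $ a $ b * (\<Sum>x\<in>UNIV - {a}. (\<Sum>y\<in>UNIV - {e}. arc_walk_sum A m b x y c) * A $ c $ e)"
    by (subst arc_walk_sum.simps(2)) (simp only: Suc.IH)
  also have "\<dots> = (\<Sum>y\<in>UNIV - {e}. A $ a $ b * (\<Sum>x\<in>UNIV - {a}. arc_walk_sum A m b x y c))
      * A $ c $ e"
    by (simp add: sum_distrib_left sum_distrib_right mult.assoc) (rule sum.swap)
  finally show ?case by simp
qed

text \<open>
  In the following three sums the walks have length \<open>m + 1\<close>, as a first arc is needed.
\<close>

definition nb_walk_matrix :: "complex ^ 'n ^ 'n \<Rightarrow> nat \<Rightarrow> complex ^ 'n ^ 'n::finite" where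
  "nb_walk_matrix A m = (\<chi> u v. \<Sum>b\<in>UNIV. \<Sum>c\<in>UNIV. arc_walk_sum A m u b c v)"

definition tailed_sum :: "complex ^ 'n ^ 'n::finite \<Rightarrow> nat \<Rightarrow> complex" where
  "tailed_sum A m = (\<Sum>u\<in>UNIV. \<Sum>b\<in>UNIV. arc_walk_sum A m u b b u)"

definition tailless_sum :: "complex ^ 'n ^ 'n::finite \<Rightarrow> nat \<Rightarrow> complex" where
  "tailless_sum A m = (\<Sum>u\<in>UNIV. \<Sum>b\<in>UNIV. \<Sum>c\<in>UNIV - {b}. arc_walk_sum A m u b c u)"

lemma tailless_sum_eq_trace_minus_tailed:
  "tailless_sum A m = trace (nb_walk_matrix A m) - tailed_sum A m"
  by (simp add: tailless_sum_def tailed_sum_def trace_def nb_walk_matrix_def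
      sum_UNIV_minus_singleton sum_subtractf)

lemma nb_walk_matrix_0: "nb_walk_matrix A 0 = A"
proof -
  have "(\<Sum>c\<in>UNIV. if u = c \<and> b = v then A $ u $ b else 0) = (if b = v then A $ u $ b else 0)"
    for u v b by (cases "b = v") simp_all
  then show ?thesis
    by (simp add: nb_walk_matrix_def vec_eq_iff)
qed

text \<open>
  Prepending an arc \<open>(u, b)\<close> to a walk from \<open>b\<close> gives a non-backtracking walk unless the
  walk returns to \<open>u\<close> at once; the walks that do so form the second summand.
\<close>

lemma mult_nb_walk_matrix:
  "(A ** nb_walk_matrix A m) $ u $ v = nb_walk_matrix A (Suc m) $ u $ v +
     (\<Sum>c\<in>UNIV. \<Sum>b\<in>UNIV. A $ u $ b * arc_walk_sum A m b u c v)"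
proof -
  have "(A ** nb_walk_matrix A m) $ u $ v =
      (\<Sum>b\<in>UNIV. A $ u $ b * (\<Sum>x\<in>UNIV. \<Sum>c\<in>UNIV. arc_walk_sum A m b x c v))"
    by (simp add: matrix_matrix_mult_def nb_walk_matrix_def)
  also have "\<dots> = (\<Sum>b\<in>UNIV. \<Sum>c\<in>UNIV. A $ u $ b * (\<Sum>x\<in>UNIV. arc_walk_sum A m b x c v))"
    by (subst sum.swap) (simp add: sum_distrib_left)
  also have "\<dots> = (\<Sum>b\<in>UNIV. \<Sum>c\<in>UNIV. arc_walk_sum A (Suc m) u b c v +
      A $ u $ b * arc_walk_sum A m b u c v)"
    by (simp add: sum_UNIV_minus_singleton algebra_simps)
  also have "\<dots> = nb_walk_matrix A (Suc m) $ u $ v +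
      (\<Sum>b\<in>UNIV. \<Sum>c\<in>UNIV. A $ u $ b * arc_walk_sum A m b u c v)"
    by (simp add: sum.distrib nb_walk_matrix_def del: arc_walk_sum.simps)
  also have "(\<Sum>b\<in>UNIV. \<Sum>c\<in>UNIV. A $ u $ b * arc_walk_sum A m b u c v) =
      (\<Sum>c\<in>UNIV. \<Sum>b\<in>UNIV. A $ u $ b * arc_walk_sum A m b u c v)"
    by (rule sum.swap)
  finally show ?thesis .
qed


section \<open>Recursions for regular unimodular weights\<close>

text \<open>
  Only two properties of a generalized adjacency matrix of a \<open>(d + 1)\<close>-regular graph enter the
  recursions: going along an arc and straight back has weight \<open>1\<close>, and there are \<open>d + 1\<close> arcs
  at each vertex. The first is stated without division or case distinction: the weight of an arc and
  its reverse acts as \<open>1\<close> on every multiple of the weight of the arc.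
\<close>

locale regular_unimodular_weights =
  fixes A :: "complex ^ 'n ^ 'n::finite" and d :: nat
  assumes back_and_forth: "A $ u $ v * (A $ u $ v * A $ v $ u) = A $ u $ v"
    and sum_back_and_forth: "(\<Sum>v\<in>UNIV. A $ u $ v * A $ v $ u) = of_nat d + 1"
begin

lemma back_and_forth_first:
  "A $ a $ b * A $ b $ a * arc_walk_sum A m a b c e = arc_walk_sum A m a b c e"
proof (cases m)
  case 0
  then show ?thesis using back_and_forth[of a b] by (auto simp: mult_ac)
next
  case (Suc l)
  have "A $ a $ b * A $ b $ a * (A $ a $ b * s) = A $ a $ b * s" for s
    using arg_cong[OF back_and_forth[of a b], of "\<lambda>z. z * s"] by (simp add: mult_ac)
  then show ?thesis by (simp add: Suc)
qed

lemma back_and_forth_last: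
  "A $ e $ c * A $ c $ e * arc_walk_sum A m a b c e = arc_walk_sum A m a b c e"
proof (cases m)
  case 0
  then show ?thesis using back_and_forth[of c e] by (auto simp: mult_ac)
next
  case (Suc l)
  have "A $ e $ c * A $ c $ e * (s * A $ c $ e) = s * A $ c $ e" for s
    using arg_cong[OF back_and_forth[of c e], of "\<lambda>z. z * s"] by (simp add: mult_ac)
  then show ?thesis by (simp only: Suc arc_walk_sum_Suc_last)
qed

lemma mult_nb_walk_matrix_0:
  "A ** A = nb_walk_matrix A 1 + (real d + 1) *\<^sub>R mat 1"
proof -
  have "(\<Sum>c\<in>UNIV. \<Sum>b\<in>UNIV. A $ u $ b * arc_walk_sum A 0 b u c v) =
      (if u = v then of_nat d + 1 else 0)" for u v
  proof -
    have "(\<Sum>c\<in>UNIV. \<Sum>b\<in>UNIV. A $ u $ b * arc_walk_sum A 0 b u c v) =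
        (\<Sum>c\<in>UNIV. if u = v then A $ u $ c * A $ c $ u else 0)"
      by (intro sum.cong refl) (cases "u = v"; simp add: if_distrib cong: if_cong)
    then show ?thesis by (simp add: sum_back_and_forth)
  qed
  then have "(A ** A) $ u $ v = nb_walk_matrix A 1 $ u $ v + (if u = v then of_nat d + 1 else 0)"
    for u v
    using mult_nb_walk_matrix[of A 0 u v] by (simp add: nb_walk_matrix_0)
  then show ?thesis
    by (simp add: vec_eq_iff mat_def) (simp add: scaleR_conv_of_real)
qed

text \<open>
  A walk that backtracks only at its second step is an arbitrary non-backtracking walk from \<open>u\<close>
  preceded by a detour along one of the \<open>d\<close> arcs at \<open>u\<close> other than its first one.
\<close>

lemma mult_nb_walk_matrix_Suc:
  "A ** nb_walk_matrix A (Suc m) = nb_walk_matrix A (Suc (Suc m)) + real d *\<^sub>R nb_walk_matrix A m"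
proof -
  have "(\<Sum>b\<in>UNIV. A $ u $ b * arc_walk_sum A (Suc m) b u c v) =
      of_nat d * (\<Sum>x\<in>UNIV. arc_walk_sum A m u x c v)" for u c v
    using weighted_sum_avoiding[of "\<lambda>b. A $ u $ b * A $ b $ u" "\<lambda>x. arc_walk_sum A m u x c v",
        OF back_and_forth_first]
    by (simp add: sum_back_and_forth mult.assoc)
  then have "(A ** nb_walk_matrix A (Suc m)) $ u $ v = nb_walk_matrix A (Suc (Suc m)) $ u $ v +
      (\<Sum>c\<in>UNIV. of_nat d * (\<Sum>x\<in>UNIV. arc_walk_sum A m u x c v))" for u v
    by (simp only: mult_nb_walk_matrix)
  moreover have "(\<Sum>c\<in>UNIV. of_nat d * (\<Sum>x\<in>UNIV. arc_walk_sum A m u x c v)) =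
      of_nat d * nb_walk_matrix A m $ u $ v" for u v
    unfolding nb_walk_matrix_def
    by (simp add: sum_distrib_left[symmetric]) (subst sum.swap, simp)
  ultimately show ?thesis
    by (simp add: vec_eq_iff) (simp add: scaleR_conv_of_real)
qed

text \<open>
  A closed walk with a tail is a closed non-backtracking walk based at \<open>b\<close> conjugated by an arc
  \<open>(u, b)\<close>, where \<open>u\<close> must avoid the first and the last step of the inner walk. These are two
  different neighbours of \<open>b\<close>, or one if the inner walk itself has a tail.
\<close>

lemma tailed_sum_rec:
  "tailed_sum A (Suc (Suc m)) = (of_nat d - 1) * trace (nb_walk_matrix A m) + tailed_sum A m"
proof -
  have inner: "(\<Sum>u\<in>UNIV. arc_walk_sum A (Suc (Suc m)) u b b u) =
      (of_nat d - 1) * (\<Sum>x\<in>UNIV. \<Sum>y\<in>UNIV. arc_walk_sum A m b x y b) +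
      (\<Sum>x\<in>UNIV. arc_walk_sum A m b x x b)" for b
  proof -
    have conjugation: "arc_walk_sum A (Suc (Suc m)) u b b u = (A $ b $ u * A $ u $ b) *
        (\<Sum>x\<in>UNIV - {u}. \<Sum>y\<in>UNIV - {u}. arc_walk_sum A m b x y b)" for u
      by (subst arc_walk_sum.simps(2), subst arc_walk_sum_Suc_last)
        (simp add: mult_ac sum_distrib_left)
    show ?thesis
      unfolding conjugation
      using weighted_sum_avoiding2[of "\<lambda>u. A $ b $ u * A $ u $ b" "\<lambda>x y. arc_walk_sum A m b x y b"]
      by (simp add: back_and_forth_first back_and_forth_last sum_back_and_forth
          del: mult_cancel_right1 mult_cancel_right2)
  qed
  have "tailed_sum A (Suc (Suc m)) = (\<Sum>b\<in>UNIV. \<Sum>u\<in>UNIV. arc_walk_sum A (Suc (Suc m)) u b b u)"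
    unfolding tailed_sum_def by (rule sum.swap)
  then show ?thesis
    unfolding inner
    by (simp add: sum.distrib trace_def nb_walk_matrix_def tailed_sum_def flip: sum_distrib_left)
qed

lemma tailless_sum_rec:
  "tailless_sum A (Suc (Suc m)) = tailless_sum A m +
     trace (nb_walk_matrix A (Suc (Suc m)) - real d *\<^sub>R nb_walk_matrix A m)"
proof -
  have "trace (real d *\<^sub>R nb_walk_matrix A m) = of_nat d * trace (nb_walk_matrix A m)"
    by (simp add: trace_def flip: scaleR_sum_right) (simp add: scaleR_conv_of_real)
  then show ?thesis
    by (simp add: tailless_sum_eq_trace_minus_tailed tailed_sum_rec trace_sub algebra_simps)
qed

end


section \<open>Chebyshev polynomials of a matrix\<close>

lemma matrix_mult_right_sum:
  "A ** (\<Sum>i\<in>I. M i) = (\<Sum>i\<in>I. A ** M i)" for A :: "complex ^ 'n ^ 'n"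
  by (induction I rule: infinite_finite_induct) (simp_all add: matrix_add_ldistrib)

lemma matrix_diff_ldistrib: "A ** (B - C) = A ** B - A ** C" for A :: "complex ^ 'n ^ 'n"
  by (simp add: vec_eq_iff matrix_matrix_mult_def sum_subtractf algebra_simps)

lemma poly_matrix_eq_sum:
  assumes "degree p \<le> N"
  shows "poly_matrix p A = (\<Sum>i\<le>N. coeff p i *\<^sub>R matrix_power A i)"
  unfolding poly_matrix_def using assms
  by (intro sum.mono_neutral_left) (auto simp: coeff_eq_0)

lemma poly_matrix_1: "poly_matrix 1 A = mat 1"
  by (simp add: poly_matrix_def matrix_power_def)

lemma poly_matrix_diff: "poly_matrix (p - q) A = poly_matrix p A - poly_matrix q A"
proof -
  let ?N = "max (degree p) (degree q)"
  have "degree (p - q) \<le> ?N" by (rule degree_diff_le_max)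
  then show ?thesis
    by (simp add: poly_matrix_eq_sum[of _ ?N] scaleR_diff_left sum_subtractf)
qed

lemma poly_matrix_smult: "poly_matrix (smult c p) A = c *\<^sub>R poly_matrix p A"
  by (simp add: poly_matrix_eq_sum[of _ "degree p"] scaleR_sum_right)

lemma poly_matrix_mult_X: "poly_matrix (pCons 0 p) A = A ** poly_matrix p A"
proof -
  have "poly_matrix (pCons 0 p) A =
      (\<Sum>i\<le>Suc (degree p). coeff (pCons 0 p) i *\<^sub>R matrix_power A i)"
    by (intro poly_matrix_eq_sum degree_pCons_le)
  also have "\<dots> = (\<Sum>i\<le>degree p. coeff p i *\<^sub>R (A ** matrix_power A i))"
    by (subst sum.atMost_Suc_shift) (simp add: matrix_power_def)
  finally show ?thesis
    by (simp add: poly_matrix_def matrix_mult_right_sum matrix_scalar_ac scalar_matrix_assoc)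
qed

lemma chebyshev_T_0: "chebyshev_T 0 = 1"
  by (rule chebyshev_T_unique[of _ 0]) (simp_all add: poly_chebyshev_T_cos)

lemma chebyshev_T_1: "chebyshev_T (Suc 0) = pCons 0 1"
  by (rule chebyshev_T_unique[of _ 1]) (simp_all add: poly_chebyshev_T_cos)

lemma chebyshev_T_Suc_Suc:
  "chebyshev_T (Suc (Suc m)) = smult 2 (pCons 0 (chebyshev_T (Suc m))) - chebyshev_T m"
proof (rule chebyshev_T_unique[of _ "Suc (Suc m)"])
  fix \<theta> :: real
  have "cos (real (Suc m) * \<theta> + \<theta>) + cos (real (Suc m) * \<theta> - \<theta>) = 2 * cos \<theta> * cos (real (Suc m) * \<theta>)"
    by (simp add: cos_add cos_diff)
  moreover have "real (Suc m) * \<theta> + \<theta> = real (Suc (Suc m)) * \<theta>" "real (Suc m) * \<theta> - \<theta> = real m * \<theta>"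
    by (auto simp: algebra_simps)
  ultimately show "poly (smult 2 (pCons 0 (chebyshev_T (Suc m))) - chebyshev_T m) (cos \<theta>) =
      cos (real (Suc (Suc m)) * \<theta>)"
    by (simp add: poly_chebyshev_T_cos)
qed (rule poly_chebyshev_T_cos)

text \<open>
  The normalisation \<open>2 d\<^sup>k\<^sup>/\<^sup>2 T\<^sub>k(A / (2 \<surd>d))\<close> is a monic integral polynomial in \<open>A\<close>
  for positive \<open>k\<close>: its recursion contains \<open>d\<close> but no square root.
\<close>

definition scaled_chebyshev :: "nat \<Rightarrow> complex ^ 'n ^ 'n \<Rightarrow> nat \<Rightarrow> complex ^ 'n ^ 'n::finite" where
  "scaled_chebyshev d A k = (2 * real d powr (real k / 2)) *\<^sub>R
     poly_matrix (chebyshev_T k) (A /\<^sub>R (2 * sqrt (real d)))"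

lemma scaled_chebyshev_0: "d \<ge> 1 \<Longrightarrow> scaled_chebyshev d A 0 = 2 *\<^sub>R mat 1"
  by (simp add: scaled_chebyshev_def chebyshev_T_0 poly_matrix_1)

lemma scaled_chebyshev_1: "d \<ge> 1 \<Longrightarrow> scaled_chebyshev d A (Suc 0) = A"
  by (simp add: scaled_chebyshev_def chebyshev_T_1 poly_matrix_mult_X poly_matrix_1 powr_half_sqrt)

lemma scaled_chebyshev_Suc_Suc:
  fixes A :: "complex ^ 'n ^ 'n::finite"
  assumes "d \<ge> 1"
  shows "scaled_chebyshev d A (Suc (Suc k)) =
    A ** scaled_chebyshev d A (Suc k) - real d *\<^sub>R scaled_chebyshev d A k"
proof -
  define B where "B = A /\<^sub>R (2 * sqrt (real d))"
  let ?M = "poly_matrix (chebyshev_T (Suc k)) B"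
  have "real (Suc (Suc k)) / 2 = 1 / 2 + real (Suc k) / 2"
    by (simp add: field_simps)
  then have step: "real d powr (real (Suc (Suc k)) / 2) = sqrt (real d) * real d powr (real (Suc k) / 2)"
    by (simp only: powr_add powr_half_sqrt of_nat_0_le_iff)
  have "real (Suc (Suc k)) / 2 = 1 + real k / 2"
    by (simp add: field_simps)
  then have step2: "real d powr (real (Suc (Suc k)) / 2) = real d * real d powr (real k / 2)"
    by (simp only: powr_add powr_one of_nat_0_le_iff)
  have "A ** scaled_chebyshev d A (Suc k) = (2 * real d powr (real (Suc k) / 2)) *\<^sub>R (A ** ?M)"
    unfolding scaled_chebyshev_def B_def[symmetric] by (simp only: matrix_scalar_ac scalar_matrix_assoc)
  also have "A ** ?M = (2 * sqrt (real d)) *\<^sub>R (B ** ?M)"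
    using assms by (simp add: B_def scalar_matrix_assoc)
  finally have "A ** scaled_chebyshev d A (Suc k) =
      (2 * real d powr (real (Suc (Suc k)) / 2)) *\<^sub>R (2 *\<^sub>R (B ** ?M))"
    unfolding step by (simp add: mult_ac)
  moreover have "real d *\<^sub>R scaled_chebyshev d A k = (2 * real d powr (real (Suc (Suc k)) / 2)) *\<^sub>R
      poly_matrix (chebyshev_T k) B"
    unfolding step2 scaled_chebyshev_def B_def by (simp add: mult_ac)
  ultimately show ?thesis
    by (simp only: scaled_chebyshev_def[of d A "Suc (Suc k)"] B_def[symmetric] chebyshev_T_Suc_Suc
        poly_matrix_diff poly_matrix_smult poly_matrix_mult_X scaleR_diff_right)
qed

lemma scaled_chebyshev_2:
  assumes "d \<ge> 1"
  shows "scaled_chebyshev d A (Suc (Suc 0)) = A ** A - (2 * real d) *\<^sub>R mat 1"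
  by (simp add: scaled_chebyshev_Suc_Suc[OF assms] scaled_chebyshev_1[OF assms]
      scaled_chebyshev_0[OF assms] mult.commute)


section \<open>Comparison of the two recursions\<close>

context regular_unimodular_weights
begin

text \<open>
  The right-hand side is the combination of walk matrices whose trace is the increment in
  \<open>tailless_sum_rec\<close>. As functions of \<open>m\<close>, both sides satisfy
  \<open>X\<^sub>m\<^sub>+\<^sub>2 = A X\<^sub>m\<^sub>+\<^sub>1 - d X\<^sub>m\<close>, so it is enough that they agree at \<open>0\<close> and \<open>1\<close>.
\<close>

lemma scaled_chebyshev_increment:
  assumes "d \<ge> 1"
  shows "scaled_chebyshev d A (m + 3) - scaled_chebyshev d A (m + 1) =
    nb_walk_matrix A (Suc (Suc m)) - real d *\<^sub>R nb_walk_matrix A m"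
proof (induction m rule: less_induct)
  case (less m)
  let ?P = "scaled_chebyshev d A" and ?C = "nb_walk_matrix A"
  note P_rec = scaled_chebyshev_Suc_Suc[OF assms]
  have C_rec: "?C (Suc (Suc i)) = A ** ?C (Suc i) - real d *\<^sub>R ?C i" for i
    by (simp add: mult_nb_walk_matrix_Suc)
  have C1: "?C (Suc 0) = A ** A - (real d + 1) *\<^sub>R mat 1"
    using mult_nb_walk_matrix_0 by simp
  note small = scaled_chebyshev_2[OF assms] scaled_chebyshev_1[OF assms]
    P_rec[of A "Suc 0"] P_rec[of A "Suc (Suc 0)"] C_rec C1
    nb_walk_matrix_0 matrix_diff_ldistrib matrix_scalar_ac scalar_matrix_assoc[symmetric]
    numeral_3_eq_3
  consider "m = 0" | "m = 1" | l where "m = Suc (Suc l)"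
    by (metis One_nat_def not0_implies_Suc)
  then show ?case
  proof cases
    case 1
    then show ?thesis by (simp add: small, simp add: vec_eq_iff algebra_simps)
        (simp add: scaleR_conv_of_real)
  next
    case 2
    then show ?thesis by (simp add: small, simp add: vec_eq_iff algebra_simps)
        (simp add: scaleR_conv_of_real)
  next
    case 3
    have IH0: "?P (Suc (Suc (Suc l))) - ?P (Suc l) = ?C (Suc (Suc l)) - real d *\<^sub>R ?C l"
      using less.IH[of l] 3 by (simp add: numeral_3_eq_3)
    have IH1: "?P (Suc (Suc (Suc (Suc l)))) - ?P (Suc (Suc l)) =
        ?C (Suc (Suc (Suc l))) - real d *\<^sub>R ?C (Suc l)"
      using less.IH[of "Suc l"] 3 by (simp add: numeral_3_eq_3)
    have "?P (m + 3) - ?P (m + 1) =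
        A ** (?P (Suc (Suc (Suc (Suc l)))) - ?P (Suc (Suc l))) -
        real d *\<^sub>R (?P (Suc (Suc (Suc l))) - ?P (Suc l))"
      unfolding 3 by (simp add: numeral_3_eq_3 P_rec[of A "Suc (Suc (Suc l))"] P_rec[of A "Suc l"]
          matrix_diff_ldistrib scaleR_diff_right)
    also have "\<dots> = ?C (Suc (Suc m)) - real d *\<^sub>R ?C m"
      unfolding IH0 IH1 3 C_rec[of "Suc (Suc l)"] C_rec[of l]
      by (simp add: matrix_diff_ldistrib scaleR_diff_right matrix_scalar_ac scalar_matrix_assoc[symmetric])
    finally show ?thesis .
  qed
qed

text \<open>
  The term \<open>(d - 1) I\<close> comes from the starting value of the even case: there are no closed
  non-backtracking walks of length 2, while \<open>2 d T\<^sub>2(A / (2 \<surd>d)) = A\<^sup>2 - 2 d I\<close> has trace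
  \<open>(d + 1) n - 2 d n\<close> on \<open>n\<close> vertices. Increasing \<open>m\<close> by two leaves this correction unchanged. The
  walks have length \<open>m + 1\<close>, so the even lengths are the odd \<open>m\<close>.
\<close>

lemma tailless_sum_eq_trace_chebyshev:
  assumes "d \<ge> 1" and loopfree: "\<And>u. A $ u $ u = 0"
  shows "tailless_sum A m =
    trace (scaled_chebyshev d A (Suc m) + (if even m then 0 else (real d - 1) *\<^sub>R mat 1))"
proof (induction m rule: less_induct)
  case (less m)
  consider "m = 0" | "m = 1" | l where "m = Suc (Suc l)"
    by (metis One_nat_def not0_implies_Suc)
  then show ?case
  proof cases
    case 1
    have "arc_walk_sum A 0 u b c u = 0" for u b c
      using loopfree by auto
    then show ?thesis
      using 1 loopfree by (simp add: tailless_sum_def scaled_chebyshev_1[OF assms(1)] trace_def)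
  next
    case 2
    have "arc_walk_sum A 1 u b c u = 0" if "c \<noteq> b" for u b c
      using that by simp
    then have "tailless_sum A 1 = 0"
      unfolding tailless_sum_def by (simp add: sum.neutral)
    moreover have "trace (scaled_chebyshev d A 2 + (real d - 1) *\<^sub>R mat 1) = 0"
    proof -
      have "scaled_chebyshev d A 2 + (real d - 1) *\<^sub>R mat 1 = A ** A - (real d + 1) *\<^sub>R mat 1"
        by (simp add: numeral_2_eq_2 scaled_chebyshev_2[OF assms(1)] vec_eq_iff)
          (simp add: scaleR_conv_of_real algebra_simps)
      then show ?thesis
        by (simp add: trace_def matrix_matrix_mult_def sum_back_and_forth mat_def)
          (simp add: scaleR_conv_of_real)
    qed
    ultimately show ?thesis
      using 2 by (simp add: numeral_2_eq_2)
  next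
    case 3
    have "tailless_sum A m = tailless_sum A l +
        trace (scaled_chebyshev d A (l + 3) - scaled_chebyshev d A (l + 1))"
      unfolding 3 scaled_chebyshev_increment[OF assms(1)] by (rule tailless_sum_rec)
    then show ?thesis
      using less.IH[of l] 3 by (simp add: trace_add trace_sub numeral_3_eq_3)
  qed
qed

end


section \<open>Sums over lists of vertices\<close>

text \<open>
  The lists counted by \<^const>\<open>arc_walk_sum\<close>. Consecutive vertices need not be adjacent: a list that
  is not a walk has weight \<open>0\<close>, so that no graph has to be carried along.
\<close>

definition nb_lists :: "nat \<Rightarrow> 'n \<Rightarrow> 'n \<Rightarrow> 'n \<Rightarrow> 'n \<Rightarrow> 'n list set" where
  "nb_lists m a b c e = {\<gamma>. length \<gamma> = m + 2 \<and> nonbacktracking \<gamma> \<and>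
     \<gamma> ! 0 = a \<and> \<gamma> ! 1 = b \<and> \<gamma> ! m = c \<and> \<gamma> ! (m + 1) = e}"

lemma finite_lists_of_length: "finite {\<gamma> :: 'n::finite list. length \<gamma> = m \<and> P \<gamma>}"
  by (rule finite_subset[OF _ finite_lists_length_eq[of UNIV m]]) auto

lemma finite_nb_lists: "finite (nb_lists m a b c (e :: 'n::finite))"
  unfolding nb_lists_def by (rule finite_lists_of_length)

lemma nonbacktracking_Cons:
  assumes "length \<gamma> \<ge> 2"
  shows "nonbacktracking (a # \<gamma>) \<longleftrightarrow> \<gamma> ! 1 \<noteq> a \<and> nonbacktracking \<gamma>"
proof
  assume *: "nonbacktracking (a # \<gamma>)"
  have "\<gamma> ! 1 \<noteq> a"
    using *[unfolded nonbacktracking_def, rule_format, of 1] assms by simp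
  moreover have "\<gamma> ! (j + 1) \<noteq> \<gamma> ! (j - 1)" if "1 \<le> j" "j + 1 \<le> vwalk_length \<gamma>" for j
    using *[unfolded nonbacktracking_def, rule_format, of "Suc j"] that by (cases j) auto
  ultimately show "\<gamma> ! 1 \<noteq> a \<and> nonbacktracking \<gamma>"
    by (simp add: nonbacktracking_def)
next
  assume *: "\<gamma> ! 1 \<noteq> a \<and> nonbacktracking \<gamma>"
  show "nonbacktracking (a # \<gamma>)"
    unfolding nonbacktracking_def
  proof (intro allI impI)
    fix j assume j: "1 \<le> j \<and> j + 1 \<le> vwalk_length (a # \<gamma>)"
    then obtain i where i: "j = Suc i" by (cases j) auto
    show "(a # \<gamma>) ! (j + 1) \<noteq> (a # \<gamma>) ! (j - 1)"
    proof (cases i)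
      case 0
      then show ?thesis using * i by simp
    next
      case (Suc l)
      then show ?thesis
        using *[THEN conjunct2, unfolded nonbacktracking_def, rule_format, of "Suc l"] j i by auto
    qed
  qed
qed

lemma path_weight_Cons:
  assumes "\<gamma> \<noteq> []"
  shows "path_weight A (a # \<gamma>) = A $ a $ (\<gamma> ! 0) * path_weight A \<gamma>"
  using assms by (cases \<gamma>) (simp_all add: path_weight_def prod.lessThan_Suc_shift del: prod.lessThan_Suc)

lemma nb_lists_0: "nb_lists 0 a b c e = (if a = c \<and> b = e then {[a, b]} else {})"
proof -
  have "\<gamma> = [a, b]" if "length \<gamma> = 2" "\<gamma> ! 0 = a" "\<gamma> ! 1 = b" for \<gamma> :: "'a list"
    using that by (auto simp: length_Suc_conv numeral_2_eq_2)
  moreover have "nonbacktracking [a, b]"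
    by (auto simp: nonbacktracking_def)
  ultimately show ?thesis
    by (auto simp: nb_lists_def)
qed

lemma nb_lists_Suc: "nb_lists (Suc m) a b c e = (\<Union>x\<in>UNIV - {a}. (#) a ` nb_lists m b x c e)"
proof (intro set_eqI iffI)
  fix \<gamma> assume g: "\<gamma> \<in> nb_lists (Suc m) a b c e"
  then obtain \<delta> where d: "\<gamma> = a # \<delta>"
    by (cases \<gamma>) (auto simp: nb_lists_def)
  then have "\<delta> \<in> nb_lists m b (\<delta> ! 1) c e" "\<delta> ! 1 \<noteq> a"
    using g nonbacktracking_Cons[of \<delta> a] by (auto simp: nb_lists_def)
  then show "\<gamma> \<in> (\<Union>x\<in>UNIV - {a}. (#) a ` nb_lists m b x c e)"
    using d by auto
next
  fix \<gamma> assume "\<gamma> \<in> (\<Union>x\<in>UNIV - {a}. (#) a ` nb_lists m b x c e)"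
  then obtain x \<delta> where "x \<noteq> a" "\<delta> \<in> nb_lists m b x c e" "\<gamma> = a # \<delta>"
    by auto
  then show "\<gamma> \<in> nb_lists (Suc m) a b c e"
    using nonbacktracking_Cons[of \<delta> a] by (auto simp: nb_lists_def)
qed

text \<open>
  Removing the first vertex of a list is the recursion of \<^const>\<open>arc_walk_sum\<close>: the third vertex \<open>x\<close>
  becomes the end of the new first arc, and not backtracking means that it differs from \<open>a\<close>.
\<close>

lemma sum_path_weight_nb_lists:
  "(\<Sum>\<gamma>\<in>nb_lists m a b c e. path_weight A \<gamma>) = arc_walk_sum A m a b c e"
proof (induction m arbitrary: a b)
  case 0
  show ?case
    by (simp add: nb_lists_0 path_weight_def)
next
  case (Suc m)
  have "(\<Sum>\<gamma>\<in>nb_lists (Suc m) a b c e. path_weight A \<gamma>) =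
      (\<Sum>x\<in>UNIV - {a}. \<Sum>\<gamma>\<in>(#) a ` nb_lists m b x c e. path_weight A \<gamma>)"
    unfolding nb_lists_Suc
    by (rule sum.UNION_disjoint) (simp, simp add: finite_nb_lists, auto simp: nb_lists_def)
  also have "\<dots> = (\<Sum>x\<in>UNIV - {a}. \<Sum>\<gamma>\<in>nb_lists m b x c e. A $ a $ b * path_weight A \<gamma>)"
  proof (rule sum.cong[OF refl])
    fix x
    have "path_weight A (a # \<gamma>) = A $ a $ b * path_weight A \<gamma>" if "\<gamma> \<in> nb_lists m b x c e" for \<gamma>
      using that by (subst path_weight_Cons) (auto simp: nb_lists_def)
    then show "(\<Sum>\<gamma>\<in>(#) a ` nb_lists m b x c e. path_weight A \<gamma>) =
        (\<Sum>\<gamma>\<in>nb_lists m b x c e. A $ a $ b * path_weight A \<gamma>)"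
      by (subst sum.reindex) (simp_all cong: sum.cong)
  qed
  finally show ?case
    by (simp add: Suc.IH flip: sum_distrib_left)
qed

lemma path_weight_eq_0_if_not_vwalk:
  assumes zero: "\<And>u v. (u, v) \<notin> parcs G \<Longrightarrow> A $ u $ v = 0" and "pverts G = UNIV"
    and "\<gamma> \<noteq> []" "\<not> vwalk \<gamma> (with_proj G)"
  shows "path_weight A \<gamma> = 0"
proof -
  have "\<not> set (vwalk_arcs \<gamma>) \<subseteq> parcs G"
    using assms(2-4) by (auto simp: vwalk_def)
  with \<open>\<gamma> \<noteq> []\<close> show ?thesis
  proof (induction \<gamma> rule: vwalk_arcs.induct)
    case (3 x y xs)
    then show ?case
      by (subst path_weight_Cons) (auto simp: zero)
  qed simp_all
qed

text \<open>
  The closed tailless walks are sorted by their base vertex, the vertex \<open>b\<close> after it and the vertex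
  \<open>c\<close> before the return; having no tail means \<open>c \<noteq> b\<close>.
\<close>

lemma sum_path_weight_closed_nb_tailless:
  fixes A :: "complex ^ 'n ^ 'n::finite"
  assumes zero: "\<And>u v. (u, v) \<notin> parcs G \<Longrightarrow> A $ u $ v = 0" and "pverts G = UNIV"
  shows "(\<Sum>\<gamma>\<in>closed_nb_tailless_paths G (Suc m). path_weight A \<gamma>) = tailless_sum A m"
proof -
  define S where "S = {\<gamma> :: 'n list. length \<gamma> = m + 2 \<and> nonbacktracking \<gamma> \<and>
    \<gamma> ! (m + 1) = \<gamma> ! 0 \<and> \<gamma> ! m \<noteq> \<gamma> ! 1}"
  define T where "T = (UNIV :: 'n set) \<times> (SIGMA b:UNIV. UNIV - {b :: 'n})"
  have fin: "finite S"
    unfolding S_def by (rule finite_lists_of_length)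
  have paths: "closed_nb_tailless_paths G (Suc m) = {\<gamma> \<in> S. vwalk \<gamma> (with_proj G)}"
  proof -
    have "\<gamma> \<in> closed_nb_tailless_paths G (Suc m) \<longleftrightarrow> \<gamma> \<in> S \<and> vwalk \<gamma> (with_proj G)" for \<gamma>
    proof (cases "length \<gamma> = m + 2")
      case True
      then show ?thesis
        by (simp add: closed_nb_tailless_paths_def S_def closed_path_def nonbacktracking_tailless_def
            conj_ac)
    next
      case False
      then have "length \<gamma> - 1 \<noteq> Suc m" by arith
      with False show ?thesis
        by (simp add: closed_nb_tailless_paths_def S_def)
    qed
    then show ?thesis by blast
  qed
  have "(\<Sum>\<gamma>\<in>closed_nb_tailless_paths G (Suc m). path_weight A \<gamma>) = (\<Sum>\<gamma>\<in>S. path_weight A \<gamma>)"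
    unfolding paths
  proof (intro sum.mono_neutral_left ballI)
    fix \<gamma> assume "\<gamma> \<in> S - {\<gamma> \<in> S. vwalk \<gamma> (with_proj G)}"
    then have "\<gamma> \<noteq> []" "\<not> vwalk \<gamma> (with_proj G)"
      by (auto simp: S_def)
    then show "path_weight A \<gamma> = 0"
      using path_weight_eq_0_if_not_vwalk[of G A] assms by blast
  qed (use fin in auto)
  also have "\<dots> = (\<Sum>t\<in>T. \<Sum>\<gamma>\<in>{\<gamma>\<in>S. (\<gamma> ! 0, \<gamma> ! 1, \<gamma> ! m) = t}. path_weight A \<gamma>)"
  proof (rule sum.group[symmetric])
    show "(\<lambda>\<gamma>. (\<gamma> ! 0, \<gamma> ! 1, \<gamma> ! m)) ` S \<subseteq> T"
      unfolding S_def T_def by blast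
  qed (simp_all add: fin T_def)
  also have "\<dots> = (\<Sum>(u, b, c)\<in>T. arc_walk_sum A m u b c u)"
  proof (rule sum.cong[OF refl])
    fix t assume "t \<in> T"
    then obtain u b c where t: "t = (u, b, c)" "c \<noteq> b"
      by (auto simp: T_def)
    have "{\<gamma>\<in>S. (\<gamma> ! 0, \<gamma> ! 1, \<gamma> ! m) = t} = nb_lists m u b c u"
      using t unfolding S_def nb_lists_def by blast
    then show "(\<Sum>\<gamma>\<in>{\<gamma>\<in>S. (\<gamma> ! 0, \<gamma> ! 1, \<gamma> ! m) = t}. path_weight A \<gamma>) =
        (case t of (u, b, c) \<Rightarrow> arc_walk_sum A m u b c u)"
      using t by (simp add: sum_path_weight_nb_lists)
  qed
  also have "\<dots> = tailless_sum A m"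
    unfolding T_def tailless_sum_def
    by (simp add: sum.Sigma)
  finally show ?thesis .
qed


section \<open>The trace formula\<close>

lemma regular_unimodular_weights_generalized_adjacency:
  fixes G :: "'n::finite pair_pre_digraph"
  assumes "pverts G = UNIV" "regular_graph (d + 1) G" "generalized_adjacency_matrix G A"
  shows "regular_unimodular_weights A d"
proof
  have mult: "A $ u $ v * A $ v $ u = (if (u, v) \<in> parcs G then 1 else 0)" for u v
  proof -
    have "A $ v $ u = cnj (A $ u $ v)"
      using assms(3) unfolding generalized_adjacency_matrix_def hermitian_def by blast
    then have "A $ u $ v * A $ v $ u = of_real ((norm (A $ u $ v))\<^sup>2)"
      by (simp only: complex_norm_square)
    moreover have "norm (A $ u $ v) = (if (u, v) \<in> parcs G then 1 else 0)"
      using assms(3) by (simp add: generalized_adjacency_matrix_def)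
    ultimately show ?thesis by simp
  qed
  show "A $ u $ v * (A $ u $ v * A $ v $ u) = A $ u $ v" for u v
    using assms(3) by (simp add: mult generalized_adjacency_matrix_def)
  show "(\<Sum>v\<in>UNIV. A $ u $ v * A $ v $ u) = of_nat d + 1" for u
  proof -
    have "out_arcs (with_proj G) u = Pair u ` {v. (u, v) \<in> parcs G}"
      by (auto simp: out_arcs_def)
    then have "card {v. (u, v) \<in> parcs G} = card (out_arcs (with_proj G) u)"
      by (simp add: card_image inj_on_def)
    then have "card {v. (u, v) \<in> parcs G} = d + 1"
      using assms(1,2) by (simp add: regular_graph_def out_degree_def)
    then show ?thesis
      by (simp add: mult sum.If_cases)
  qed
qed

theorem theorem2p2:
  fixes G :: "'n::finite pair_pre_digraph"
    and A :: "complex ^ 'n ^ 'n"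
    and d k :: nat
  assumes "d \<ge> 1"
    and "pair_graph G"
    and "pverts G = UNIV"
    and "regular_graph (d + 1) G"
    and "generalized_adjacency_matrix G A"
    and "k \<ge> 1"
  shows "(\<Sum>\<gamma> \<in> closed_nb_tailless_paths G k. path_weight A \<gamma>) =
    (if odd k
     then trace ((2 * real d powr (real k / 2)) *\<^sub>R
            poly_matrix (chebyshev_T k) (A /\<^sub>R (2 * sqrt (real d))))
     else trace ((2 * real d powr (real k / 2)) *\<^sub>R
            poly_matrix (chebyshev_T k) (A /\<^sub>R (2 * sqrt (real d)))
            + (real d - 1) *\<^sub>R mat 1))"
proof -
  interpret regular_unimodular_weights A d
    using assms(3-5) by (rule regular_unimodular_weights_generalized_adjacency)
  interpret pair_graph G
    by fact
  have zero: "A $ u $ v = 0" if "(u, v) \<notin> parcs G" for u v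
    using assms(5) that by (simp add: generalized_adjacency_matrix_def)
  have loopfree: "A $ u $ u = 0" for u
    using zero[of u u] no_loops by force
  obtain m where k: "k = Suc m"
    using assms(6) by (cases k) auto
  have "(\<Sum>\<gamma> \<in> closed_nb_tailless_paths G k. path_weight A \<gamma>) = tailless_sum A m"
    unfolding k using zero assms(3) by (rule sum_path_weight_closed_nb_tailless)
  also have "\<dots> = trace (scaled_chebyshev d A k + (if even m then 0 else (real d - 1) *\<^sub>R mat 1))"
    unfolding k using assms(1) loopfree by (rule tailless_sum_eq_trace_chebyshev)
  finally show ?thesis
    by (simp add: scaled_chebyshev_def k)
qed

end
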